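(* Consider the admission-control and capacity-allocation Markov decision process described in the context, with arbitrary (positive) cost parameters $c_o,c_r,c_1^e,c_2^e$. Early service of a job is suboptimal unless there is remaining capacity after serving the jobs that are due in the current period. That is: let $s=(x,a)\in\mathcal{S}$ and let $d=(r,y)\in\mathcal{D}_s$ be an action with $y_{10}+y_{20}\ge M$ and with $y_{ij}\ge 1$ for some $i\in\{1,2\}$ and some $j\in\{1,\dots,K-1\}$. Then $d$ is suboptimal in state $s$.
   Context: Notation: $(z)^+=[z]^+=\max(z,0)$. Parameters: integers $K\ge 2$ (customer order horizon), $M\ge 1$ (service capacity per period), $A\ge 1$ (maximum number of arrivals per class and requested period); positive real costs $c_o$ (overtime, per job), $c_r$ (rejection, per job), $c_i^e$ (early service of a class-$i$ job, per job and per period of earliness), $i=1,2$. Class $1$ is high-priority, class $2$ is low-priority. For $i=1,2$, $0\le j<K$, $p_{ij}$ is a probability distribution on $\{0,\dots,A\}$ with $p_{ij}(0)>0$. States: $\mathcal{S}$ is the finite set of pairs $s=(x,a)$ with $x=(x_{ij})$, $a=(a_{ij})$, $i=1,2$, $0\le j<K$, nonnegative integers, where $x_{ij}$ is the number of already admitted class-$i$ jobs due $j$ periods from now, and $a_{ij}$ is the number of newly arrived class-$i$ requests due $j$ periods from now; $a_{ij}\le A$, $x_{20}=0$, $x_{10}\le 2(K-1)A$, and $x_{ij}\le (K-1-j)A$ for $1\le j\le K-1$. Actions: $\mathcal{D}_s$ is the set of $d=(r,y)$ with $r=(r_j)_{0\le j<K}$, $y=(y_{ij})$ nonnegative integers,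 where $r_j$ is the number of arriving low-priority requests due in $j$ periods that are rejected and $y_{ij}$ is the number of class-$i$ jobs due in $j$ periods that are served now, subject to $r_j\le a_{2j}$, $y_{1j}\le x_{1j}+a_{1j}$, $y_{2j}\le x_{2j}+a_{2j}-r_j$, and (no late service) $y_{10}=x_{10}+a_{10}$, $y_{20}=x_{20}+a_{20}-r_0$. Serving a job with $j\ge1$ is early service. Transitions: from $s=(x,a)$ under $d=(r,y)$ the next state is $(x',a')$ with $x'_{10}=(x_{11}+a_{11}-y_{11})+(x_{21}+a_{21}-r_1-y_{21})$, $x'_{20}=0$, $x'_{1j}=x_{1,j+1}+a_{1,j+1}-y_{1,j+1}$ and $x'_{2j}=x_{2,j+1}+a_{2,j+1}-r_{j+1}-y_{2,j+1}$ for $1\le j\le K-2$, $x'_{i,K-1}=0$ for those of these components not already defined, and $a'_{ij}$ independent with distributions $p_{ij}$. This defines $P(s'|s,d)$. One-period cost: $c(s,d)=c_o\big(\sum_{i=1}^2\sum_{j=0}^{K-1}y_{ij}-M\big)^+ + c_r\sum_{j=0}^{K-1}r_j+\sum_{j=1}^{K-1}j\,(c_1^e y_{1j}+c_2^e y_{2j})$. The objective is to minimize the long-run average cost; the MDP is unichain and $(g,h)$ denotes a solution of the optimality equation $g+h(s)=\min_{d\in\mathcal{D}_s}\{c(s,d)+\sum_{s'\in\mathcal{S}}P(s'|s,d)h(s')\}$ for all $s\in\mathcal{S}$. An action $d\in\mathcal{D}_s$ is called suboptimal in state $s$ if it does not attain the minimum in the optimality equation at $s$. *)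

theory Defs
  imports "HOL-Probability.Probability"
begin

text \<open>
  The pair \<open>(i, j)\<close> indexes class \<open>i\<close> (1 = high priority, 2 = low priority) and
  residual time \<open>j < K\<close> until the due date.  Arrays are total functions that vanish off
  \<open>index K\<close> (for rejections: off \<open>{..<K}\<close>), so that each array over the index set has exactly
  one representative and the sets of states and actions are finite.
\<close>

type_synonym jobs = "nat \<times> nat \<Rightarrow> nat"
type_synonym state = "jobs \<times> jobs"  \<comment> \<open>admitted jobs \<open>x\<close>, new arrivals \<open>a\<close>\<close>
type_synonym action = "(nat \<Rightarrow> nat) \<times> jobs"  \<comment> \<open>rejections \<open>r\<close>, services \<open>y\<close>\<close>

definition index :: "nat \<Rightarrow> (nat \<times> nat) set" where
  "index K = {1, 2} \<times> {..<K}"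

definition states :: "nat \<Rightarrow> nat \<Rightarrow> state set" where
  "states K A = {(x, a).
     (\<forall>ij. ij \<notin> index K \<longrightarrow> x ij = 0 \<and> a ij = 0) \<and>
     (\<forall>ij\<in>index K. a ij \<le> A) \<and>
     x (2, 0) = 0 \<and> x (1, 0) \<le> 2 * (K - 1) * A \<and>
     (\<forall>i\<in>{1, 2}. \<forall>j\<in>{1..K - 1}. x (i, j) \<le> (K - 1 - j) * A)}"

text \<open>
  Subtractions below are on natural numbers; none of them truncates for an action satisfying
  these constraints.
\<close>

fun actions :: "nat \<Rightarrow> state \<Rightarrow> action set" where
  "actions K (x, a) = {(r, y).
     (\<forall>j. j \<ge> K \<longrightarrow> r j = 0) \<and> (\<forall>ij. ij \<notin> index K \<longrightarrow> y ij = 0) \<and>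
     (\<forall>j<K. r j \<le> a (2, j) \<and>
             y (1, j) \<le> x (1, j) + a (1, j) \<and>
             y (2, j) \<le> x (2, j) + a (2, j) - r j) \<and>
     y (1, 0) = x (1, 0) + a (1, 0) \<and>
     y (2, 0) = x (2, 0) + a (2, 0) - r 0}"

text \<open>Admitted low-priority jobs that become due are merged into the class-1 jobs due now.\<close>

fun next_jobs :: "nat \<Rightarrow> state \<Rightarrow> action \<Rightarrow> jobs" where
  "next_jobs K (x, a) (r, y) (i, j) =
     (if i = 1 \<and> j = 0 then
        (x (1, 1) + a (1, 1) - y (1, 1)) + (x (2, 1) + a (2, 1) - r 1 - y (2, 1))
      else if i = 1 \<and> 1 \<le> j \<and> j \<le> K - 2 then
        x (1, j + 1) + a (1, j + 1) - y (1, j + 1)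
      else if i = 2 \<and> 1 \<le> j \<and> j \<le> K - 2 then
        x (2, j + 1) + a (2, j + 1) - r (j + 1) - y (2, j + 1)
      else 0)"

definition transition ::
  "nat \<Rightarrow> (nat \<times> nat \<Rightarrow> nat pmf) \<Rightarrow> state \<Rightarrow> action \<Rightarrow> state pmf" where
  "transition K p s d = map_pmf (\<lambda>a'. (next_jobs K s d, a')) (Pi_pmf (index K) 0 p)"

fun cost ::
  "nat \<Rightarrow> nat \<Rightarrow> real \<Rightarrow> real \<Rightarrow> (nat \<Rightarrow> real) \<Rightarrow> action \<Rightarrow> real" where
  "cost K M co cr ce (r, y) =
     co * max (real (\<Sum>i=1..2. \<Sum>j=0..K - 1. y (i, j)) - real M) 0
     + cr * real (\<Sum>j=0..K - 1. r j)
     + (\<Sum>j=1..K - 1. real j * (ce 1 * real (y (1, j)) + ce 2 * real (y (2, j))))"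

definition action_value ::
  "nat \<Rightarrow> nat \<Rightarrow> nat \<Rightarrow> real \<Rightarrow> real \<Rightarrow> (nat \<Rightarrow> real) \<Rightarrow> (nat \<times> nat \<Rightarrow> nat pmf)
    \<Rightarrow> (state \<Rightarrow> real) \<Rightarrow> state \<Rightarrow> action \<Rightarrow> real" where
  "action_value K M A co cr ce p h s d =
     cost K M co cr ce d + (\<Sum>s'\<in>states K A. pmf (transition K p s d) s' * h s')"

definition solves_optimality_equation ::
  "nat \<Rightarrow> nat \<Rightarrow> nat \<Rightarrow> real \<Rightarrow> real \<Rightarrow> (nat \<Rightarrow> real) \<Rightarrow> (nat \<times> nat \<Rightarrow> nat pmf)
    \<Rightarrow> real \<Rightarrow> (state \<Rightarrow> real) \<Rightarrow> bool" where
  "solves_optimality_equation K M A co cr ce p g h \<longleftrightarrow>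
     (\<forall>s\<in>states K A. g + h s = (MIN d\<in>actions K s. action_value K M A co cr ce p h s d))"

definition suboptimal ::
  "nat \<Rightarrow> nat \<Rightarrow> nat \<Rightarrow> real \<Rightarrow> real \<Rightarrow> (nat \<Rightarrow> real) \<Rightarrow> (nat \<times> nat \<Rightarrow> nat pmf)
    \<Rightarrow> (state \<Rightarrow> real) \<Rightarrow> state \<Rightarrow> action \<Rightarrow> bool" where
  "suboptimal K M A co cr ce p h s d \<longleftrightarrow>
     action_value K M A co cr ce p h s d
       \<noteq> (MIN d'\<in>actions K s. action_value K M A co cr ce p h s d')"

text \<open>The minima above range over finite nonempty sets, and the state space is closed.\<close>

lemma finite_index: "finite (index K)"
  by (simp add: index_def)

lemma finite_actions: "finite (actions K s)"
proof (cases s)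
  case (Pair x a)
  define B where "B = Max ((\<lambda>ij. x ij + a ij) ` index K)"
  have B: "x ij + a ij \<le> B" if "ij \<in> index K" for ij
    unfolding B_def using that finite_index by (intro Max_ge) auto
  let ?R = "{r :: nat \<Rightarrow> nat. \<forall>j. (j \<in> {..<K} \<longrightarrow> r j \<in> {..B}) \<and> (j \<notin> {..<K} \<longrightarrow> r j = 0)}"
  let ?Y = "{y :: jobs. \<forall>ij. (ij \<in> index K \<longrightarrow> y ij \<in> {..B}) \<and> (ij \<notin> index K \<longrightarrow> y ij = 0)}"
  have "actions K s \<subseteq> ?R \<times> ?Y"
  proof
    fix d assume d: "d \<in> actions K s"
    obtain r y where ry: "d = (r, y)" by (cases d)
    have "r j \<le> B" if "j < K" for j
      using d that B[of "(2, j)"] unfolding ry Pair by (force simp: index_def)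
    moreover have "y (i, j) \<le> B" if "(i, j) \<in> index K" for i j
      using d that B[of "(i, j)"] unfolding ry Pair by (force simp: index_def)
    ultimately show "d \<in> ?R \<times> ?Y"
      using d unfolding ry Pair by auto
  qed
  moreover have "finite ?R" by (rule finite_set_of_finite_funs) auto
  moreover have "finite ?Y" by (rule finite_set_of_finite_funs) (auto simp: finite_index)
  ultimately show ?thesis by (meson finite_SigmaI finite_subset)
qed

lemma actions_nonempty:
  assumes "K \<ge> 1"
  shows "actions K s \<noteq> {}"
proof (cases s)
  case (Pair x a)
  have "((\<lambda>_. 0), (\<lambda>(i, j). if i \<in> {1, 2} \<and> j = 0 then x (i, j) + a (i, j) else 0))
          \<in> actions K s"
    using assms unfolding Pair by (auto simp: index_def)
  then show ?thesis by blast
qed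

lemma finite_states: "finite (states K A)"
proof -
  let ?F = "\<lambda>B. {f :: jobs. \<forall>ij. (ij \<in> index K \<longrightarrow> f ij \<in> {..B}) \<and> (ij \<notin> index K \<longrightarrow> f ij = 0)}"
  have "states K A \<subseteq> ?F (2 * (K - 1) * A) \<times> ?F A"
  proof
    fix s assume s: "s \<in> states K A"
    obtain x a where xa: "s = (x, a)" by (cases s)
    have "x (i, j) \<le> 2 * (K - 1) * A" if "(i, j) \<in> index K" for i j
    proof (cases "j = 0")
      case True
      then show ?thesis using s that unfolding xa by (auto simp: index_def states_def)
    next
      case False
      then have "x (i, j) \<le> (K - 1 - j) * A"
        using s that unfolding xa by (auto simp: index_def states_def)
      also have "\<dots> \<le> 2 * (K - 1) * A" by (intro mult_right_mono) auto
      finally show ?thesis .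
    qed
    then show "s \<in> ?F (2 * (K - 1) * A) \<times> ?F A"
      using s unfolding xa by (auto simp: states_def)
  qed
  moreover have "finite (?F B)" for B
    by (rule finite_set_of_finite_funs) (auto simp: finite_index)
  ultimately show ?thesis by (meson finite_SigmaI finite_subset)
qed

lemma transition_closed:
  assumes K: "K \<ge> 2" and s: "s \<in> states K A" and d: "d \<in> actions K s"
    and p: "\<And>i j. i \<in> {1, 2} \<Longrightarrow> j < K \<Longrightarrow> set_pmf (p (i, j)) \<subseteq> {0..A}"
  shows "set_pmf (transition K p s d) \<subseteq> states K A"
proof
  fix s' assume "s' \<in> set_pmf (transition K p s d)"
  then obtain a' where s': "s' = (next_jobs K s d, a')"
    and "a' \<in> set_pmf (Pi_pmf (index K) 0 p)"
    by (auto simp: transition_def)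
  then have a': "a' \<in> PiE_dflt (index K) 0 (set_pmf \<circ> p)"
    by (simp add: set_Pi_pmf finite_index)
  obtain x a where xa: "s = (x, a)" by (cases s)
  obtain r y where ry: "d = (r, y)" by (cases d)
  have a'0: "a' ij = 0" if "ij \<notin> index K" for ij
    using a' that by (cases ij) (auto simp: PiE_dflt_def)
  have a'A: "a' ij \<le> A" if "ij \<in> index K" for ij
  proof -
    obtain i j where ij: "ij = (i, j)" by (cases ij)
    have "a' (i, j) \<in> set_pmf (p (i, j))" using a' that unfolding ij PiE_dflt_def by simp
    moreover have "i \<in> {1, 2}" "j < K" using that unfolding ij index_def by auto
    ultimately show ?thesis using p[of i j] unfolding ij by fastforce
  qed
  have xb: "\<forall>i\<in>{1, 2}. \<forall>j\<in>{1..K - 1}. x (i, j) \<le> (K - 1 - j) * A"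
    and ab: "\<forall>ij\<in>index K. a ij \<le> A"
    using s unfolding xa states_def by blast+
  have bnd: "x (i, j + 1) + a (i, j + 1) \<le> (K - 1 - j) * A"
    if "i \<in> {1, 2}" "j + 1 < K" for i j
  proof -
    have m: "j + 1 \<in> {1..K - 1}" "(i, j + 1) \<in> index K" using that by (simp_all add: index_def)
    have "K - 1 - j = Suc (K - 1 - (j + 1))" using that by linarith
    then have "(K - 1 - j) * A = A + (K - 1 - (j + 1)) * A" by (metis mult_Suc)
    moreover have "x (i, j + 1) \<le> (K - 1 - (j + 1)) * A" using xb that(1) m(1) by blast
    moreover have "a (i, j + 1) \<le> A" using ab m(2) by blast
    ultimately show ?thesis by linarith
  qed
  have b1: "x (1, j + 1) + a (1, j + 1) - k \<le> (K - 1 - j) * A" if "j + 1 < K" for j k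
    using bnd[of 1 j] that by (meson diff_le_self insertI1 le_trans)
  have b2: "x (2, j + 1) + a (2, j + 1) - k - l \<le> (K - 1 - j) * A" if "j + 1 < K" for j k l
    using bnd[of 2 j] that by (meson diff_le_self insertI1 insertI2 le_trans)
  have n0: "next_jobs K s d (1, 0) \<le> 2 * (K - 1) * A"
  proof -
    have "next_jobs K s d (1, 0) \<le> (K - 1) * A + (K - 1) * A"
      unfolding xa ry next_jobs.simps using b1[of 0] b2[of 0] K
      by (simp only: add_0 simp_thms if_True diff_zero) (rule add_mono; simp)
    then show ?thesis by (simp only: mult_2 distrib_right mult.assoc)
  qed
  have nj: "next_jobs K s d (i, j) \<le> (K - 1 - j) * A"
    if "i \<in> {1, 2}" "j \<in> {1..K - 1}" for i j
  proof (cases "j \<le> K - 2")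
    case True
    have j: "1 \<le> j" "j + 1 < K" "j \<noteq> 0" using that True K by auto
    have "i = 1 \<or> i = 2" using that by blast
    then show ?thesis
    proof
      assume "i = 1"
      then have "next_jobs K s d (i, j) = x (1, j + 1) + a (1, j + 1) - y (1, j + 1)"
        unfolding xa ry using j True by simp
      then show ?thesis using b1[OF j(2)] by (simp only:)
    next
      assume "i = 2"
      then have "next_jobs K s d (i, j)
          = x (2, j + 1) + a (2, j + 1) - r (j + 1) - y (2, j + 1)"
        unfolding xa ry using j True by simp
      then show ?thesis using b2[OF j(2)] by (simp only:)
    qed
  next
    case False
    then have "next_jobs K s d (i, j) = 0" using that unfolding xa ry by simp
    then show ?thesis by simp
  qed
  have nz: "next_jobs K s d ij = 0" if "ij \<notin> index K" for ij
  proof -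
    obtain i j where ij: "ij = (i, j)" by (cases ij)
    have "\<not> (i = 1 \<and> j < K)" "\<not> (i = 2 \<and> j < K)"
      using that unfolding ij index_def by auto
    then show ?thesis using K unfolding xa ry ij by (auto simp del: One_nat_def)
  qed
  have n2: "next_jobs K s d (2, 0) = 0" unfolding xa ry by simp
  show "s' \<in> states K A"
    unfolding s' states_def using a'0 a'A n0 nj nz n2 by blast
qed

end

theory Submission
  imports Defs
begin

text \<open>
  A job that is present in the next period can always be served right then, at a cost of at most
  \<open>co\<close> plus its earliness cost at that time, without changing the rest of the evolution.  Hence
  \<open>h (x + e, a) \<le> h (x, a) + co + j * ce i\<close> for a unit vector \<open>e\<close> at \<open>(i, j)\<close>.  If an action uses
  up the capacity on due jobs and serves a job \<open>(i, j)\<close> early, postponing that job saves exactly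
  \<open>co + j * ce i\<close> now and costs at most \<open>co + (j - 1) * ce i\<close> later.
\<close>

section \<open>Effect of one additional service on the one-period cost\<close>

lemma total_service_Suc:
  fixes y :: jobs
  assumes "i \<in> {1, 2}" "j \<le> n"
  shows "(\<Sum>k=1..2. \<Sum>l=0..n. (y((i, j) := Suc (y (i, j)))) (k, l))
           = Suc (\<Sum>k=1..2. \<Sum>l=0..n. y (k, l))"
proof -
  have "(y((i, j) := Suc (y (i, j)))) (k, l) 
      = y (k, l) + (if k = i then if l = j then 1 else 0 else 0)"
    for k l by simp
  moreover have "(\<Sum>k=1..2. \<Sum>l=0..n. if k = i then if l = j then 1 else 0 else 0) = (1::nat)"
  proof -
    have "(\<Sum>l=0..n. if k = i then if l = j then 1 else 0 else 0) = (if k = i then 1 else 0 :: nat)" for k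
      using assms(2) by (cases "k = i") (simp_all add: sum.delta)
    moreover have "i \<in> {1..2}" using assms(1) by auto
    ultimately show ?thesis by (simp add: sum.delta del: One_nat_def)
  qed
  ultimately show ?thesis by (simp only: sum.distrib)
qed

lemma early_cost_Suc:
  fixes y :: jobs and ce :: "nat \<Rightarrow> real"
  assumes "i \<in> {1, 2}" "j \<le> n"
  shows "(\<Sum>l=1..n. real l * (ce 1 * real ((y((i, j) := Suc (y (i, j)))) (1, l))
             + ce 2 * real ((y((i, j) := Suc (y (i, j)))) (2, l))))
         = (\<Sum>l=1..n. real l * (ce 1 * real (y (1, l)) + ce 2 * real (y (2, l)))) + real j * ce i"
proof -
  have "real l * (ce 1 * real ((y((i, j) := Suc (y (i, j)))) (1, l))
             + ce 2 * real ((y((i, j) := Suc (y (i, j)))) (2, l)))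
      = real l * (ce 1 * real (y (1, l)) + ce 2 * real (y (2, l)))
         + (if l = j then real j * ce i else 0)" for l
    using assms(1) by (auto simp: algebra_simps)
  moreover have "(\<Sum>l=1..n. if l = j then real j * ce i else 0) = real j * ce i"
    \<comment> \<open>For \<open>j = 0\<close> the range of summation misses \<open>j\<close>, but
      the right-hand side vanishes as well, so jobs due now are covered too.\<close>
    using assms(2) by (cases "j = 0") (simp_all add: sum.delta)
  ultimately show ?thesis by (simp only: sum.distrib)
qed

text \<open>The overtime \<open>max (n - M) 0\<close> grows by at most one when \<open>n\<close>
  does. This bounds the price of serving a postponed job one period later, when the load is
  unknown.\<close>

lemma cost_Suc_le:
  assumes "i \<in> {1, 2}" "j < K" "co \<ge> 0"
  shows "cost K M co cr ce (r, y((i, j) := Suc (y (i, j))))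
           \<le> cost K M co cr ce (r, y) + co + real j * ce i"
proof -
  have j: "j \<le> K - 1" using assms(2) by simp
  have "co * max (real (Suc n) - real M) 0 \<le> co * max (real n - real M) 0 + co" for n
  proof -
    have "co * max (real (Suc n) - real M) 0 \<le> co * (max (real n - real M) 0 + 1)"
      using assms(3) by (intro mult_left_mono) auto
    then show ?thesis by (simp add: distrib_left)
  qed
  from this[of "\<Sum>k=1..2. \<Sum>l=0..K - 1. y (k, l)"] show ?thesis
    unfolding cost.simps total_service_Suc[OF assms(1) j] early_cost_Suc[OF assms(1) j]
    by linarith
qed

text \<open>From \<open>M\<close> jobs on, overtime is linear with slope one. The hypothesis counts
  the load without the extra job, so all of that job falls into overtime.\<close>

lemma cost_Suc_eq:
  assumes "i \<in> {1, 2}" "j < K" "(\<Sum>k=1..2. \<Sum>l=0..K - 1. y (k, l)) \<ge> M"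
  shows "cost K M co cr ce (r, y((i, j) := Suc (y (i, j))))
           = cost K M co cr ce (r, y) + co + real j * ce i"
proof -
  have j: "j \<le> K - 1" using assms(2) by simp
  have "co * max (real (Suc n) - real M) 0 = co * max (real n - real M) 0 + co" if "n \<ge> M" for n
    using that by (simp add: max_def algebra_simps)
  from this[OF assms(3)] show ?thesis
    unfolding cost.simps total_service_Suc[OF assms(1) j] early_cost_Suc[OF assms(1) j]
    by simp
qed

section \<open>Feasibility and next states when a job is added or postponed\<close>

lemma actions_serve_added_job:
  assumes "(r, y) \<in> actions K (x, a)" "i \<in> {1, 2}" "j < K"
  shows "(r, y((i, j) := Suc (y (i, j)))) \<in> actions K (x((i, j) := Suc (x (i, j))), a)"
proof -
  \<comment> \<open>Hence \<open>x + a - r\<close> does not truncate in class 2 and rises by exactly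
    one with \<open>x\<close>, matching the rise of \<open>y\<close>.\<close>
  have "r j \<le> a (2, j)" if "j < K" for j using assms(1) that by simp
  with assms show ?thesis
    by (auto simp: index_def Suc_diff_le trans_le_add2)
qed

text \<open>The extra job enters \<open>x\<close> and \<open>y\<close> at the same index and cancels
  in each difference. In class 2, \<open>r j \<le> a (2, j)\<close> lets the successor pass through
  the subtraction of \<open>r j\<close>.\<close>

lemma next_jobs_serve_added_job:
  assumes "(r, y) \<in> actions K (x, a)"
  shows "next_jobs K (x((i, j) := Suc (x (i, j))), a) (r, y((i, j) := Suc (y (i, j))))
           = next_jobs K (x, a) (r, y)"
proof -
  have "r j \<le> a (2, j)" for j
    using assms by (cases "j < K") simp_all
  then show ?thesis
    by (auto simp: fun_eq_iff Suc_diff_le trans_le_add2)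
qed

text \<open>For \<open>j \<ge> 1\<close> services are only bounded above; at \<open>j = 0\<close>
  they are prescribed by the ban on late service, hence the third hypothesis.\<close>

lemma actions_antimono:
  assumes "(r, y') \<in> actions K (x, a)" "\<And>ij. y ij \<le> y' ij" "\<And>i. y (i, 0) = y' (i, 0)"
  shows "(r, y) \<in> actions K (x, a)"
proof -
  have "y ij = 0" if "ij \<notin> index K" for ij
    using assms(1) assms(2)[of ij] that by (cases ij) auto
  moreover have "y (1, j) \<le> x (1, j) + a (1, j)" "y (2, j) \<le> x (2, j) + a (2, j) - r j" if "j < K" for j
  proof -
    have "y' (1, j) \<le> x (1, j) + a (1, j)" "y' (2, j) \<le> x (2, j) + a (2, j) - r j"
      using assms(1) that by simp_all
    then show "y (1, j) \<le> x (1, j) + a (1, j)" "y (2, j) \<le> x (2, j) + a (2, j) - r j"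
      using assms(2) le_trans by blast+
  qed
  ultimately show ?thesis
    using assms(1) by (simp add: assms(3))
qed

text \<open>The postponed job is one period closer to its due date. If it becomes due, it is merged
  into class 1 whatever its class was, which explains the case \<open>j = 1\<close> in
  \<open>e\<close>.\<close>

lemma next_jobs_postpone:
  assumes "(r, y((i, j) := Suc (y (i, j)))) \<in> actions K (x, a)"
    and "i \<in> {1, 2}" "0 < j" "j < K"
    and e: "e = (if j = 1 then (1, 0) else (i, j - 1))"
  shows "next_jobs K (x, a) (r, y)
           = (next_jobs K (x, a) (r, y((i, j) := Suc (y (i, j)))))
               (e := Suc (next_jobs K (x, a) (r, y((i, j) := Suc (y (i, j)))) e))"
proof -
  \<comment> \<open>Feasibility of the larger action guarantees a job to leave unserved, so the
    truncated differences really differ by one.\<close>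
  have class1: "x (1, j) + a (1, j) - y (1, j)
      = Suc (x (1, j) + a (1, j) - Suc (y (1, j)))" if "i = 1"
    using assms(1,4) that by (auto simp: Suc_diff_Suc Suc_le_eq)
  have class2: "x (2, j) + a (2, j) - r j - y (2, j)
      = Suc (x (2, j) + a (2, j) - r j - Suc (y (2, j)))"
    if "i = 2"
    using assms(1,4) that by (auto simp: Suc_diff_Suc Suc_le_eq)
  consider "i = 1" "j = 1" | "i = 2" "j = 1" | "i = 1" "j \<ge> 2" | "i = 2" "j \<ge> 2"
    using assms(2,3) by fastforce
  then show ?thesis
  proof cases
    case 1
    show ?thesis unfolding e using \<open>0 < j\<close> \<open>j < K\<close> 1 class1 by (auto simp: fun_eq_iff)
  next
    case 2
    show ?thesis unfolding e using \<open>0 < j\<close> \<open>j < K\<close> 2 class2 by (auto simp: fun_eq_iff)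
  next
    case 3
    obtain m where "j = Suc (Suc m)" using 3(2) by (metis add_2_eq_Suc le_Suc_ex)
    then show ?thesis unfolding e using 3 class1 assms(4) by (auto simp: fun_eq_iff)
  next
    case 4
    obtain m where "j = Suc (Suc m)" using 4(2) by (metis add_2_eq_Suc le_Suc_ex)
    then show ?thesis unfolding e using 4 class2 assms(4) by (auto simp: fun_eq_iff)
  qed
qed

section \<open>Expectations over arrivals and the optimality equation\<close>

lemma finite_set_pmf_arrivals:
  fixes p :: "nat \<times> nat \<Rightarrow> nat pmf"
  assumes "\<forall>i\<in>{1, 2}. \<forall>j<K. set_pmf (p (i, j)) \<subseteq> {0..A}"
  shows "finite (set_pmf (Pi_pmf (index K) 0 p))"
proof -
  have "finite (set_pmf (p ij))" if "ij \<in> index K" for ij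
  proof -
    have "set_pmf (p ij) \<subseteq> {0..A}" using assms that by (auto simp: index_def)
    then show ?thesis by (rule finite_subset) simp
  qed
  then show ?thesis
    by (simp add: set_Pi_pmf finite_index finite_PiE_dflt)
qed

text \<open>The action determines the remaining jobs and leaves the law of the arrivals alone, so
  different actions, even in different states, can be compared under the same arrivals. Closedness
  of \<open>states K A\<close> ensures that the finite sum loses no mass.\<close>

lemma action_value_expectation:
  assumes K: "K \<ge> 2" and s: "s \<in> states K A" and d: "d \<in> actions K s"
    and p: "\<forall>i\<in>{1, 2}. \<forall>j<K. set_pmf (p (i, j)) \<subseteq> {0..A}"
  shows "action_value K M A co cr ce p h s d
           = cost K M co cr ce d
             + measure_pmf.expectation (Pi_pmf (index K) 0 p) (\<lambda>a'. h (next_jobs K s d, a'))"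
proof -
  have "set_pmf (transition K p s d) \<subseteq> states K A"
    by (rule transition_closed[OF K s d]) (use p in blast)
  then have "measure_pmf.expectation (transition K p s d) h
      = (\<Sum>s'\<in>states K A. h s' * pmf (transition K p s d) s')"
    by (intro integral_measure_pmf_real) (auto simp: finite_states)
  then show ?thesis
    by (simp add: action_value_def transition_def mult.commute)
qed

lemma optimality_equation_le:
  assumes "solves_optimality_equation K M A co cr ce p g h" "s \<in> states K A" "d \<in> actions K s"
  shows "g + h s \<le> action_value K M A co cr ce p h s d"
  using assms finite_actions[of K s] by (auto simp: solves_optimality_equation_def)

lemma optimality_equation_attained:
  assumes "solves_optimality_equation K M A co cr ce p g h" "s \<in> states K A" "K \<ge> 1"
  obtains d where "d \<in> actions K s" "g + h s = action_value K M A co cr ce p h s d"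
proof -
  have "(MIN d\<in>actions K s. action_value K M A co cr ce p h s d)
          \<in> action_value K M A co cr ce p h s ` actions K s"
    using finite_actions actions_nonempty[OF assms(3)] by (intro Min_in) auto
  then show thesis
    using that assms(1,2) by (auto simp: solves_optimality_equation_def)
qed

section \<open>Comparison of relative values and of actions\<close>

lemma relative_value_added_job_le:
  assumes K: "K \<ge> 2" and co: "co \<ge> 0"
    and p: "\<forall>i\<in>{1, 2}. \<forall>j<K. set_pmf (p (i, j)) \<subseteq> {0..A}"
    and opt: "solves_optimality_equation K M A co cr ce p g h"
    and s: "(x, a) \<in> states K A" and s1: "(x((i, j) := Suc (x (i, j))), a) \<in> states K A"
    and ij: "i \<in> {1, 2}" "j < K"
  shows "h (x((i, j) := Suc (x (i, j))), a) \<le> h (x, a) + co + real j * ce i"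
proof -
  \<comment> \<open>An optimal action for the smaller state, extended by serving the added job, is a
    candidate in the larger one with the same next state.\<close>
  obtain d where d: "d \<in> actions K (x, a)"
    and v: "g + h (x, a) = action_value K M A co cr ce p h (x, a) d"
    by (rule optimality_equation_attained[OF opt s]) (use K in auto)
  obtain r y where ry: "d = (r, y)" by (cases d)
  let ?x = "x((i, j) := Suc (x (i, j)))" and ?y = "y((i, j) := Suc (y (i, j)))"
  have d1: "(r, ?y) \<in> actions K (?x, a)"
    using actions_serve_added_job d ij unfolding ry by blast
  have "g + h (?x, a) \<le> action_value K M A co cr ce p h (?x, a) (r, ?y)"
    by (rule optimality_equation_le[OF opt s1 d1])
  also have "\<dots> \<le> action_value K M A co cr ce p h (x, a) d + co + real j * ce i"
    unfolding action_value_expectation[OF K s1 d1 p] action_value_expectation[OF K s d p]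
    unfolding ry next_jobs_serve_added_job[OF d[unfolded ry]]
    using cost_Suc_le[where ce = ce, OF ij co, of M cr r y] by linarith
  finally show ?thesis using v by simp
qed

lemma action_value_postpone_less:
  assumes K: "K \<ge> 2" and co: "co \<ge> 0" and ce: "ce i > 0"
    and p: "\<forall>i\<in>{1, 2}. \<forall>j<K. set_pmf (p (i, j)) \<subseteq> {0..A}"
    and opt: "solves_optimality_equation K M A co cr ce p g h"
    and s: "(x, a) \<in> states K A"
    and d: "(r, y((i, j) := Suc (y (i, j)))) \<in> actions K (x, a)"
    and ij: "i \<in> {1, 2}" "0 < j" "j < K"
    and M: "(\<Sum>k=1..2. \<Sum>l=0..K - 1. y (k, l)) \<ge> M"
  shows "action_value K M A co cr ce p h (x, a) (r, y)
           < action_value K M A co cr ce p h (x, a) (r, y((i, j) := Suc (y (i, j))))"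
proof -
  let ?y = "y((i, j) := Suc (y (i, j)))"
  let ?P = "Pi_pmf (index K) 0 p"
  let ?n = "next_jobs K (x, a) (r, y)" and ?n1 = "next_jobs K (x, a) (r, ?y)"
  define e where "e = (if j = 1 then (1, 0) else (i, j - 1))"
  obtain k l where kl: "e = (k, l)" by (cases e)
  \<comment> \<open>For \<open>j = 1\<close> the class may change from 2 to 1, but both earliness
    costs are then zero, so \<open>ce 1\<close> and \<open>ce 2\<close> need not be
    compared.\<close>
  have k: "k \<in> {1, 2}" "l < K" and l: "real l * ce k = real (j - 1) * ce i"
    using ij kl by (auto simp: e_def split: if_splits)
  have d0: "(r, y) \<in> actions K (x, a)" by (rule actions_antimono[OF d]) (use ij(2) in auto)
  have n: "?n = ?n1((k, l) := Suc (?n1 (k, l)))"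
    using next_jobs_postpone[OF d ij e_def] unfolding kl .
  have closed: "set_pmf (transition K p (x, a) (r, y)) \<subseteq> states K A"
    "set_pmf (transition K p (x, a) (r, ?y)) \<subseteq> states K A"
    by (rule transition_closed[OF K s d0] transition_closed[OF K s d]; use p in blast)+
  \<comment> \<open>The bound for an added job is applied separately for each arrival vector;
    closedness puts both next states in \<open>states K A\<close>.\<close>
  have le: "h (?n, a') \<le> h (?n1, a') + (co + real (j - 1) * ce i)" if "a' \<in> set_pmf ?P" for a'
  proof -
    have "(?n, a') \<in> states K A" "(?n1, a') \<in> states K A"
      using closed that by (auto simp: transition_def)
    then show ?thesis
      using relative_value_added_job_le[where ce = ce, OF K co p opt _ _ k]
      unfolding n l[symmetric] add.assoc
      by metis
  qed
  have int: "integrable (measure_pmf ?P) f" for f :: "jobs \<Rightarrow> real"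
    using finite_set_pmf_arrivals[OF p] by (rule integrable_measure_pmf_finite)
  have "measure_pmf.expectation ?P (\<lambda>a'. h (?n, a'))
      \<le> measure_pmf.expectation ?P (\<lambda>a'. h (?n1, a') + (co + real (j - 1) * ce i))"
    using le by (intro integral_mono_AE int) (simp add: AE_measure_pmf_iff)
  also have "\<dots> = measure_pmf.expectation ?P (\<lambda>a'. h (?n1, a')) + (co + real (j - 1) * ce i)"
    by (simp add: int)
  \<comment> \<open>The strict gap is one period of earliness, \<open>ce i\<close>.\<close>
  also have "\<dots> < measure_pmf.expectation ?P (\<lambda>a'. h (?n1, a')) + co + real j * ce i"
    using ij(2) ce by simp
  finally show ?thesis
    unfolding action_value_expectation[OF K s d0 p] action_value_expectation[OF K s d p]
      cost_Suc_eq[OF ij(1,3) M]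
    by linarith
qed

theorem proposition1:
  fixes K M A :: nat
    and co cr :: real and ce :: "nat \<Rightarrow> real"
    and p :: "nat \<times> nat \<Rightarrow> nat pmf"
    and g :: real and h :: "state \<Rightarrow> real"
    and x a y :: jobs and r :: "nat \<Rightarrow> nat"
  assumes "K \<ge> 2" and "M \<ge> 1" and "A \<ge> 1"
    and "co > 0" and "cr > 0" and "ce 1 > 0" and "ce 2 > 0"
    and "\<forall>i\<in>{1, 2}. \<forall>j<K. set_pmf (p (i, j)) \<subseteq> {0..A} \<and> pmf (p (i, j)) 0 > 0"
    and "solves_optimality_equation K M A co cr ce p g h"
    and "(x, a) \<in> states K A"
    and "(r, y) \<in> actions K (x, a)"
    and "y (1, 0) + y (2, 0) \<ge> M"
    and "\<exists>i\<in>{1, 2}. \<exists>j\<in>{1..K - 1}. y (i, j) \<ge> 1"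
  shows "suboptimal K M A co cr ce p h (x, a) (r, y)"
proof -
  note K = \<open>K \<ge> 2\<close> and s = \<open>(x, a) \<in> states K A\<close> and d = \<open>(r, y) \<in> actions K (x, a)\<close>
  have p: "\<forall>i\<in>{1, 2}. \<forall>j<K. set_pmf (p (i, j)) \<subseteq> {0..A}"
    using assms(8) by simp
  obtain i j where i: "i \<in> {1, 2}" and "j \<in> {1..K - 1}" and y: "y (i, j) \<ge> 1"
    using assms(13) by blast
  then have j: "0 < j" "j < K" using K by auto
  have ce: "ce i > 0" using i assms(6,7) by auto
  \<comment> \<open>The action \<open>z\<close> postpones one early job. Since \<open>j > 0\<close>,
    the services of due jobs are unchanged and alone still reach \<open>M\<close>.\<close>
  define z where "z = y((i, j) := y (i, j) - 1)"
  have yz: "y = z((i, j) := Suc (z (i, j)))"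
    using y by (simp add: z_def)
  have "M \<le> z (1, 0) + z (2, 0)" using assms(12) j by (simp add: z_def)
  also have "\<dots> = (\<Sum>k=1..2. z (k, 0))" by (simp add: numeral_2_eq_2)
  also have "\<dots> \<le> (\<Sum>k=1..2. \<Sum>l=0..K - 1. z (k, l))"
    by (intro sum_mono member_le_sum) auto
  finally have M: "M \<le> (\<Sum>k=1..2. \<Sum>l=0..K - 1. z (k, l))" .
  have d1: "(r, z((i, j) := Suc (z (i, j)))) \<in> actions K (x, a)"
    using d unfolding yz[symmetric] .
  have d0: "(r, z) \<in> actions K (x, a)"
    by (rule actions_antimono[OF d1]) (use j(1) in auto)
  have "(MIN d'\<in>actions K (x, a). action_value K M A co cr ce p h (x, a) d')
          \<le> action_value K M A co cr ce p h (x, a) (r, z)"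
    using finite_actions d0 by (intro Min_le) auto
  also have "\<dots> < action_value K M A co cr ce p h (x, a) (r, y)"
    using action_value_postpone_less[where ce = ce, OF K less_imp_le[OF assms(4)] ce p assms(9) s d1 i j M]
    unfolding yz[symmetric] .
  finally show ?thesis unfolding suboptimal_def by simp
qed

end
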